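(* Define the vector field $\bm G$ on $\mathbb{R}^3$ by $$\bm G=2x(y^2+z^2)\,\bm e_x+y(y^2+z^2-x^2)\,\bm e_y+z(y^2+z^2-x^2)\,\bm e_z .$$ Then $\bm G$ is in the $xOr$ plane and is orthogonal to the vector field $\bm F=(x^2-y^2-z^2)\,\bm e_x+2xy\,\bm e_y+2xz\,\bm e_z$.
   Context: $\bm e_x,\bm e_y,\bm e_z$ is the standard basis of $\mathbb{R}^3$. Cylindrical coordinates $(x,r,\theta)$ about the $x$-axis are defined by $y=r\cos\theta$, $z=r\sin\theta$, with basis vectors $\bm e_x$, $\bm e_r=\cos\theta\,\bm e_y+\sin\theta\,\bm e_z$, $\bm e_\theta=-\sin\theta\,\bm e_y+\cos\theta\,\bm e_z$. The $xOr$ plane at a point with angle $\theta$ is the plane through the $x$-axis containing the point, spanned by $\bm e_x$ and $\bm e_r$; a vector field is in the $xOr$ plane if at every point its $\bm e_\theta$-component is zero. Orthogonality means that the Euclidean inner product vanishes at every point. *)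

theory Defs
  imports "HOL-Analysis.Analysis"
begin

definition e_x :: "real^3" where "e_x = axis 1 1"
definition e_y :: "real^3" where "e_y = axis 2 1"
definition e_z :: "real^3" where "e_z = axis 3 1"

definition e_r :: "real \<Rightarrow> real^3" where
  "e_r \<theta> = cos \<theta> *\<^sub>R e_y + sin \<theta> *\<^sub>R e_z"

definition e_theta :: "real \<Rightarrow> real^3" where
  "e_theta \<theta> = - sin \<theta> *\<^sub>R e_y + cos \<theta> *\<^sub>R e_z"

definition cyl_point :: "real \<Rightarrow> real \<Rightarrow> real \<Rightarrow> real^3" where
  "cyl_point x r \<theta> = vector [x, r * cos \<theta>, r * sin \<theta>]"

text \<open>The frame is orthonormal, so components are inner products with its vectors.\<close>

lemma cyl_frame_expansion:
  "v = (v \<bullet> e_x) *\<^sub>R e_x + (v \<bullet> e_r \<theta>) *\<^sub>R e_r \<theta> + (v \<bullet> e_theta \<theta>) *\<^sub>R e_theta \<theta>"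
proof -
  have a: "a = (a * c + b * s) * c - (b * c - a * s) * s"
    and b: "b = (a * c + b * s) * s + (b * c - a * s) * c"
    if "s\<^sup>2 + c\<^sup>2 = 1" for a b c s :: real
    using that by algebra+
  show ?thesis
    using a[OF sin_cos_squared_add[of \<theta>], of "v $ 2" "v $ 3"]
      b[OF sin_cos_squared_add[of \<theta>], of "v $ 3" "v $ 2"]
    by (simp add: vec_eq_iff forall_3 inner_vec_def sum_3 axis_def
        e_x_def e_y_def e_z_def e_r_def e_theta_def)
qed

text \<open>On the axis (\<open>r = 0\<close>) the angle of a point is not determined; there the
  component is required to vanish for every choice of angle.\<close>

definition in_xOr_plane :: "(real^3 \<Rightarrow> real^3) \<Rightarrow> bool" where
  "in_xOr_plane V \<longleftrightarrow>
     (\<forall>x r \<theta>. 0 \<le> r \<longrightarrow> V (cyl_point x r \<theta>) \<bullet> e_theta \<theta> = 0)"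

definition orthogonal_fields :: "(real^3 \<Rightarrow> real^3) \<Rightarrow> (real^3 \<Rightarrow> real^3) \<Rightarrow> bool" where
  "orthogonal_fields V W \<longleftrightarrow> (\<forall>p. orthogonal (V p) (W p))"

definition F_field :: "real^3 \<Rightarrow> real^3" where
  "F_field p = (let x = p $ 1; y = p $ 2; z = p $ 3 in
     (x\<^sup>2 - y\<^sup>2 - z\<^sup>2) *\<^sub>R e_x + (2 * x * y) *\<^sub>R e_y + (2 * x * z) *\<^sub>R e_z)"

definition G_field :: "real^3 \<Rightarrow> real^3" where
  "G_field p = (let x = p $ 1; y = p $ 2; z = p $ 3 in
     (2 * x * (y\<^sup>2 + z\<^sup>2)) *\<^sub>R e_x
     + (y * (y\<^sup>2 + z\<^sup>2 - x\<^sup>2)) *\<^sub>R e_y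
     + (z * (y\<^sup>2 + z\<^sup>2 - x\<^sup>2)) *\<^sub>R e_z)"

end

theory Submission
  imports Defs
begin

text \<open>With r^2 = y^2 + z^2, the fields are G = 2xr^2 \<open>e_x\<close> + r(r^2 - x^2)
  \<open>e_r\<close> and F = (x^2 - r^2) \<open>e_x\<close> + 2xr \<open>e_r\<close>. The (y, z)
  part of G is a multiple of (y, z), hence radial; on the axis it vanishes, so every angle is
  admissible.\<close>

lemma G_field_in_xOr_plane: "in_xOr_plane G_field"
  by (simp add: in_xOr_plane_def G_field_def cyl_point_def e_theta_def e_x_def e_y_def e_z_def
      Let_def inner_vec_def sum_3 axis_def)

text \<open>The axial product 2xr^2(x^2 - r^2) cancels the radial one 2xr^2(r^2 - x^2), a polynomial
  identity in x, y, z.\<close>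

lemma G_field_orthogonal_F_field: "orthogonal_fields G_field F_field"
  by (simp add: orthogonal_fields_def orthogonal_def G_field_def F_field_def e_x_def e_y_def e_z_def
      Let_def inner_vec_def sum_3 axis_def power2_eq_square algebra_simps)

theorem lemma1:
  shows "in_xOr_plane G_field \<and> orthogonal_fields G_field F_field"
  using G_field_in_xOr_plane G_field_orthogonal_F_field ..

end
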